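(* Let $(X,d,s)$ be a complete b-metric space, with $s\ge1$, and let $T:X\to X$ be a map such that for some $k\in[0,\frac1s)$ and for all $x,y\in X$, $$d(Tx,Ty)\le k\max\{d(x,y),\,d(x,Tx),\,d(y,Ty),\,d(x,Ty),\,d(y,Tx)\}.$$ If $X$ is $T$-orbitally complete, then $T$ has a unique fixed point.
   Context: A b-metric space $(X,d,s)$, $s\ge1$ real, is a nonempty set $X$ with $d:X\times X\to[0,\infty)$ such that $d(x,y)=0$ iff $x=y$, $d(x,y)=d(y,x)$, and $d(x,z)\le s\,(d(x,y)+d(y,z))$ for all $x,y,z\in X$. A sequence $(x_n)$ converges to $x$ if $d(x_n,x)\to0$, is Cauchy if $d(x_n,x_m)\to0$ as $n,m\to\infty$, and $X$ is complete if every Cauchy sequence converges to a point of $X$. $X$ is $T$-orbitally complete if every Cauchy sequence contained in the orbit $\{x,Tx,T^2x,\dots\}$ of some point $x\in X$ converges in $X$. *)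

theory Defs
  imports Complex_Main "HOL-Library.FuncSet"
begin

text \<open>The distance is a total function on the ambient type; it is constrained only on the
  carrier \<open>X\<close>.\<close>

locale b_metric_space =
  fixes X :: "'a set" and d :: "'a \<Rightarrow> 'a \<Rightarrow> real" and s :: real
  assumes carrier_nonempty: "X \<noteq> {}"
    and coeff_ge_1: "s \<ge> 1"
    and nonneg: "\<lbrakk>x \<in> X; y \<in> X\<rbrakk> \<Longrightarrow> 0 \<le> d x y"
    and zero_iff: "\<lbrakk>x \<in> X; y \<in> X\<rbrakk> \<Longrightarrow> d x y = 0 \<longleftrightarrow> x = y"
    and sym: "\<lbrakk>x \<in> X; y \<in> X\<rbrakk> \<Longrightarrow> d x y = d y x"
    and relaxed_triangle: "\<lbrakk>x \<in> X; y \<in> X; z \<in> X\<rbrakk> \<Longrightarrow> d x z \<le> s * (d x y + d y z)"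

definition b_converges :: "('a \<Rightarrow> 'a \<Rightarrow> real) \<Rightarrow> (nat \<Rightarrow> 'a) \<Rightarrow> 'a \<Rightarrow> bool" where
  "b_converges d \<sigma> x \<longleftrightarrow> (\<lambda>n. d (\<sigma> n) x) \<longlonglongrightarrow> 0"

definition b_Cauchy :: "('a \<Rightarrow> 'a \<Rightarrow> real) \<Rightarrow> (nat \<Rightarrow> 'a) \<Rightarrow> bool" where
  "b_Cauchy d \<sigma> \<longleftrightarrow> (\<forall>\<epsilon>>0. \<exists>N. \<forall>n\<ge>N. \<forall>m\<ge>N. \<bar>d (\<sigma> n) (\<sigma> m)\<bar> < \<epsilon>)"

definition b_complete :: "'a set \<Rightarrow> ('a \<Rightarrow> 'a \<Rightarrow> real) \<Rightarrow> bool" where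
  "b_complete X d \<longleftrightarrow>
     (\<forall>\<sigma>. range \<sigma> \<subseteq> X \<longrightarrow> b_Cauchy d \<sigma> \<longrightarrow> (\<exists>x\<in>X. b_converges d \<sigma> x))"

definition fwd_orbit :: "('a \<Rightarrow> 'a) \<Rightarrow> 'a \<Rightarrow> 'a set" where
  "fwd_orbit T x = range (\<lambda>n. (T ^^ n) x)"

text \<open>The sequence may be any Cauchy sequence with values in an orbit, not only the sequence of
  iterates itself.\<close>

definition orbitally_complete :: "'a set \<Rightarrow> ('a \<Rightarrow> 'a \<Rightarrow> real) \<Rightarrow> ('a \<Rightarrow> 'a) \<Rightarrow> bool" where
  "orbitally_complete X d T \<longleftrightarrow>
     (\<forall>x\<in>X. \<forall>\<sigma>. range \<sigma> \<subseteq> fwd_orbit T x \<longrightarrow> b_Cauchy d \<sigma> \<longrightarrow> (\<exists>y\<in>X. b_converges d \<sigma> y))"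

end

theory Submission
  imports Defs
begin

text \<open>If \<open>\<delta>\<close> is the diameter of \<open>x\<^sub>0, \<dots>, x\<^sub>n\<close>, where \<open>x\<^sub>i = T\<^sup>i x\<close>, then all distances not
  involving \<open>x\<^sub>0\<close> are at most \<open>k \<delta>\<close>, so the relaxed triangle inequality through \<open>x\<^sub>1\<close> gives
  \<open>\<delta> \<le> s d(x\<^sub>0, x\<^sub>1) + s k \<delta>\<close>. As \<open>s k < 1\<close>, this bounds the orbit, and each further iterate shrinks
  the diameter of its tail by the factor \<open>k\<close>; hence the orbit is Cauchy, with a limit \<open>u\<close>.
  The distance need not be continuous, so with \<open>D = d(u, Tu)\<close> one bounds \<open>d(x\<^sub>n, Tu)\<close> first by about
  \<open>s D\<close>, next by about \<open>s k D < D\<close>, and then by \<open>k D\<close>; thus \<open>D \<le> s k D\<close> and \<open>D = 0\<close>.\<close>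

locale b_metric_quasicontraction = b_metric_space +
  fixes T :: "'a \<Rightarrow> 'a" and k :: real
  assumes self_map: "x \<in> X \<Longrightarrow> T x \<in> X"
    and k_nonneg: "0 \<le> k"
    and sk_less_1: "s * k < 1"
    and quasicontraction: "\<lbrakk>x \<in> X; y \<in> X\<rbrakk> \<Longrightarrow>
      d (T x) (T y) \<le> k * Max {d x y, d x (T x), d y (T y), d x (T y), d y (T x)}"
begin

lemma k_less_1: "k < 1"
  using sk_less_1 mult_right_mono[OF coeff_ge_1 k_nonneg] by simp

lemma dist_self: "x \<in> X \<Longrightarrow> d x x = 0"
  using zero_iff by blast

lemma funpow_closed: "x \<in> X \<Longrightarrow> (T ^^ n) x \<in> X"
  by (induction n) (auto simp: self_map)

text \<open>With a free upper bound \<open>B\<close>, later arguments check five separate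
  inequalities and never handle \<open>Max\<close>.\<close>

lemma quasicontraction_le:
  assumes "x \<in> X" "y \<in> X"
    and "d x y \<le> B" "d x (T x) \<le> B" "d y (T y) \<le> B" "d x (T y) \<le> B" "d y (T x) \<le> B"
  shows "d (T x) (T y) \<le> k * B"
proof -
  have "Max {d x y, d x (T x), d y (T y), d x (T y), d y (T x)} \<le> B"
    using assms by simp
  then show ?thesis
    by (rule order_trans[OF quasicontraction[OF assms(1,2)] mult_left_mono[OF _ k_nonneg]])
qed

text \<open>The five distances in the maximum join iterates with indices among \<open>i\<close>,
  \<open>Suc i\<close>, \<open>j\<close>, \<open>Suc j\<close>. Asking for \<open>B\<close> on just
  these indices serves both a finite initial segment of the orbit and a tail.\<close>

lemma orbit_contraction:
  assumes x: "x \<in> X"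
    and bound: "\<And>p q. \<lbrakk>p \<in> {i, Suc i, j, Suc j}; q \<in> {i, Suc i, j, Suc j}\<rbrakk> \<Longrightarrow>
      d ((T ^^ p) x) ((T ^^ q) x) \<le> B"
  shows "d ((T ^^ Suc i) x) ((T ^^ Suc j) x) \<le> k * B"
  using quasicontraction_le[OF funpow_closed[OF x, of i] funpow_closed[OF x, of j], of B]
    bound[of i j] bound[of i "Suc i"] bound[of j "Suc j"] bound[of i "Suc j"] bound[of j "Suc i"]
  by simp

lemma orbit_bounded:
  assumes x: "x \<in> X"
  shows "d ((T ^^ i) x) ((T ^^ j) x) \<le> s * d x (T x) / (1 - s * k)"
proof -
  define z where "z i = (T ^^ i) x" for i
  have zX: "z i \<in> X" for i
    using funpow_closed[OF x] by (simp add: z_def)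
  define n where "n = Suc (max i j)"
  define P where "P = {..n} \<times> {..n}"
  define \<delta> where "\<delta> = Max ((\<lambda>(p, q). d (z p) (z q)) ` P)"
  have P: "finite P" "P \<noteq> {}"
    by (auto simp: P_def)
  have le_\<delta>: "d (z p) (z q) \<le> \<delta>" if "p \<le> n" "q \<le> n" for p q
    unfolding \<delta>_def by (rule Max_ge) (use that P in \<open>auto simp: P_def\<close>)
  have \<delta>_nonneg: "0 \<le> \<delta>"
    using le_\<delta>[of 0 0] nonneg[OF zX zX, of 0 0] by simp
  have inner: "d (z (Suc p)) (z (Suc q)) \<le> k * \<delta>" if "Suc p \<le> n" "Suc q \<le> n" for p q
    unfolding z_def
    by (rule orbit_contraction[OF x], fold z_def, rule le_\<delta>) (use that in auto)
  \<comment> \<open>This lets pairs without index 0, bounded by \<open>k * \<delta>\<close> alone,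
    share one bound with the pairs that go through \<open>z 1\<close>.\<close>
  have step: "k * \<delta> \<le> s * k * \<delta>"
    using coeff_ge_1 k_nonneg \<delta>_nonneg mult_right_mono[of 1 s "k * \<delta>"] by (simp add: mult.assoc)
  have s_d: "0 \<le> s * d (z 0) (z 1)"
    using nonneg[OF zX zX] coeff_ge_1 by simp
  have outer: "d (z 0) (z (Suc q)) \<le> s * d (z 0) (z 1) + s * k * \<delta>" if "Suc q \<le> n" for q
  proof -
    have "d (z 0) (z (Suc q)) \<le> s * (d (z 0) (z 1) + d (z 1) (z (Suc q)))"
      by (rule relaxed_triangle[OF zX zX zX])
    also have "\<dots> \<le> s * (d (z 0) (z 1) + k * \<delta>)"
      using inner[of 0 q] that coeff_ge_1 by (intro mult_left_mono) (auto simp: n_def)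
    finally show ?thesis
      by (simp add: algebra_simps)
  qed
  have "d (z p) (z q) \<le> s * d (z 0) (z 1) + s * k * \<delta>" if "p \<le> n" "q \<le> n" for p q
  proof (cases p; cases q)
    assume "p = 0" "q = 0"
    then show ?thesis
      using s_d step mult_nonneg_nonneg[OF k_nonneg \<delta>_nonneg] dist_self[OF zX, of 0] by simp
  next
    fix q' assume "p = 0" "q = Suc q'"
    then show ?thesis using outer that by simp
  next
    fix p' assume "p = Suc p'" "q = 0"
    then show ?thesis using outer that sym[OF zX zX] by simp
  next
    fix p' q' assume "p = Suc p'" "q = Suc q'"
    then show ?thesis using inner[of p' q'] that s_d step by simp
  qed
  \<comment> \<open>The maximum is attained at some pair, so the common bound passes to \<delta>
    itself.\<close>
  then have "\<delta> \<le> s * d (z 0) (z 1) + s * k * \<delta>"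
    using Max_in[of "(\<lambda>(p, q). d (z p) (z q)) ` P"] P unfolding \<delta>_def[symmetric]
    by (auto simp: P_def)
  then have "\<delta> * (1 - s * k) \<le> s * d (z 0) (z 1)"
    by (simp add: algebra_simps)
  then have "\<delta> \<le> s * d (z 0) (z 1) / (1 - s * k)"
    using sk_less_1 by (simp add: pos_le_divide_eq)
  moreover have "d (z i) (z j) \<le> \<delta>"
    by (rule le_\<delta>) (auto simp: n_def)
  ultimately show ?thesis
    by (simp add: z_def)
qed

text \<open>Lowering both indices by one leaves all four indices of \<open>orbit_contraction\<close>
  at least \<open>n\<close>. The induction hypothesis is needed at several pairs of them, hence
  \<open>i\<close> and \<open>j\<close> are generalized.\<close>

lemma orbit_tail_bound:
  assumes x: "x \<in> X" and "n \<le> i" "n \<le> j"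
  shows "d ((T ^^ i) x) ((T ^^ j) x) \<le> k ^ n * (s * d x (T x) / (1 - s * k))"
  using assms(2,3)
proof (induction n arbitrary: i j)
  case 0
  then show ?case using orbit_bounded[OF x] by simp
next
  case (Suc n)
  then obtain i' j' where ij: "i = Suc i'" "j = Suc j'" "n \<le> i'" "n \<le> j'"
    by (metis Suc_le_D Suc_le_mono)
  have "d ((T ^^ Suc i') x) ((T ^^ Suc j') x) \<le> k * (k ^ n * (s * d x (T x) / (1 - s * k)))"
    by (rule orbit_contraction[OF x], rule Suc.IH) (use ij in auto)
  then show ?case
    by (simp add: ij mult.assoc)
qed

lemma orbit_Cauchy:
  assumes x: "x \<in> X"
  shows "b_Cauchy d (\<lambda>n. (T ^^ n) x)"
  unfolding b_Cauchy_def
proof (intro allI impI)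
  fix e :: real assume "0 < e"
  have "(\<lambda>n. k ^ n * (s * d x (T x) / (1 - s * k))) \<longlonglongrightarrow> 0"
    using LIMSEQ_power_zero[of k] k_nonneg k_less_1 by (intro tendsto_mult_left_zero) simp
  then have "\<forall>\<^sub>F n in sequentially. k ^ n * (s * d x (T x) / (1 - s * k)) < e"
    using \<open>0 < e\<close> by (rule order_tendstoD)
  then obtain N where "k ^ N * (s * d x (T x) / (1 - s * k)) < e"
    by (auto simp: eventually_sequentially)
  then have "\<bar>d ((T ^^ n) x) ((T ^^ m) x)\<bar> < e" if "N \<le> n" "N \<le> m" for n m
    using orbit_tail_bound[OF x that] nonneg[OF funpow_closed[OF x] funpow_closed[OF x], of n m]
    by simp
  then show "\<exists>N. \<forall>n\<ge>N. \<forall>m\<ge>N. \<bar>d ((T ^^ n) x) ((T ^^ m) x)\<bar> < e"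
    by blast
qed

lemma orbit_limit_fixed:
  assumes x: "x \<in> X" and u: "u \<in> X" and conv: "b_converges d (\<lambda>n. (T ^^ n) x) u"
  shows "T u = u"
proof (rule ccontr)
  assume "T u \<noteq> u"
  define z where "z n = (T ^^ n) x" for n
  define D where "D = d u (T u)"
  have zX: "z n \<in> X" for n
    using funpow_closed[OF x] by (simp add: z_def)
  have z_Suc: "z (Suc n) = T (z n)" for n
    by (simp add: z_def)
  have Tu: "T u \<in> X"
    using self_map[OF u] .
  have D_pos: "0 < D"
    using nonneg[OF u Tu] zero_iff[OF u Tu] \<open>T u \<noteq> u\<close> by (auto simp: D_def)
  have s_pos: "0 < s"
    using coeff_ge_1 by simp
  \<comment> \<open>Chosen so that \<open>s * (e + k * D) = D\<close> exactly; this closes both the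
    second bound and the final contradiction.\<close>
  define e where "e = (1 - s * k) * D / s"
  have e_pos: "0 < e" and s_e: "s * e = (1 - s * k) * D"
    using s_pos sk_less_1 D_pos by (auto simp: e_def)
  have "e \<le> s * e"
    using mult_right_mono[OF coeff_ge_1, of e] e_pos by simp
  also have "s * e \<le> D"
    using s_e mult_right_mono[of "1 - s * k" 1 D] D_pos s_pos k_nonneg by simp
  finally have e_le_D: "e \<le> D" .
  have "\<forall>\<^sub>F n in sequentially. d (z n) u < e"
    using conv e_pos unfolding b_converges_def z_def by (rule order_tendstoD)
  then obtain N1 where N1: "\<And>n. N1 \<le> n \<Longrightarrow> d (z n) u < e"
    by (auto simp: eventually_sequentially)
  obtain N2 where N2: "\<And>n m. \<lbrakk>N2 \<le> n; N2 \<le> m\<rbrakk> \<Longrightarrow> d (z n) (z m) < e"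
    using orbit_Cauchy[OF x] e_pos unfolding b_Cauchy_def z_def by (meson abs_less_iff)
  define N where "N = max N1 N2"
  \<comment> \<open>For \<open>n\<close> at least \<open>N\<close>, three of the five distances are
    below \<open>e\<close>, hence below \<open>D\<close>, and a fourth is \<open>D\<close>. Only
    \<open>d (z n) (T u)\<close> remains, so a bound on it can be fed back and improved.\<close>
  have step: "d (z (Suc n)) (T u) \<le> k * B" if "N \<le> n" "D \<le> B" "d (z n) (T u) \<le> B" for n B
    unfolding z_Suc
  proof (rule quasicontraction_le[OF zX u])
    show "d (z n) u \<le> B" "d u (T (z n)) \<le> B"
      using N1[of n] N1[of "Suc n"] that e_le_D sym[OF u zX, of "Suc n"]
      by (auto simp: N_def z_Suc)
    show "d (z n) (T (z n)) \<le> B"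
      using N2[of n "Suc n"] that e_le_D by (auto simp: N_def z_Suc)
  qed (use that in \<open>auto simp: D_def\<close>)
  have "d (z N) (T u) \<le> s * (d (z N) u + D)"
    unfolding D_def by (rule relaxed_triangle[OF zX u Tu])
  also have "\<dots> \<le> s * (e + D)"
    using N1[of N] s_pos by (intro mult_left_mono) (auto simp: N_def)
  finally have "d (z N) (T u) \<le> s * (e + D)" .
  moreover have "D \<le> s * (e + D)"
    using mult_mono[OF coeff_ge_1, of D "e + D"] e_pos D_pos s_pos by simp
  ultimately have "d (z (Suc N)) (T u) \<le> k * (s * (e + D))"
    by (intro step) auto
  also have "\<dots> = k * (s * e) + s * k * D"
    by (simp add: algebra_simps)
  also have "\<dots> \<le> 1 * (s * e) + s * k * D"
    using k_less_1 e_pos s_pos by (intro add_right_mono mult_right_mono) auto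
  also have "\<dots> = D"
    using s_e by (simp add: algebra_simps)
  \<comment> \<open>The bound has now come down to \<open>D\<close>, the least \<open>B\<close> that
    \<open>step\<close> admits, so \<open>step\<close> applies once more with
    \<open>B = D\<close>.\<close>
  finally have a: "d (z (Suc (Suc N))) (T u) \<le> k * D"
    by (intro step) auto
  have "D \<le> s * (d u (z (Suc (Suc N))) + d (z (Suc (Suc N))) (T u))"
    unfolding D_def by (rule relaxed_triangle[OF u zX Tu])
  \<comment> \<open>Strict because \<open>d (z n) u < e\<close> is strict; the chain thus ends in
    \<open>D < D\<close>.\<close>
  also have "\<dots> < s * (e + k * D)"
    using a N1[of "Suc (Suc N)"] sym[OF u zX] s_pos
    by (intro mult_strict_left_mono add_less_le_mono) (auto simp: N_def)
  also have "\<dots> = D"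
    using s_e by (simp add: algebra_simps)
  finally show False
    by simp
qed

text \<open>At two fixed points each of the five distances is 0 or \<open>d x y\<close>, and
  \<open>k < 1\<close> forces \<open>d x y = 0\<close>.\<close>

lemma fixed_point_unique:
  assumes "x \<in> X" "y \<in> X" "T x = x" "T y = y"
  shows "x = y"
proof -
  have "d x y \<le> k * d x y"
    using quasicontraction_le[OF assms(1,2), of "d x y"] nonneg[OF assms(1,2)] assms
      sym[OF assms(1,2)] dist_self by simp
  then have "d x y * (1 - k) \<le> 0"
    by (simp add: algebra_simps)
  then have "d x y \<le> 0"
    using k_less_1 by (simp add: mult_le_0_iff)
  then show ?thesis
    using nonneg[OF assms(1,2)] zero_iff[OF assms(1,2)] by simp
qed

lemma ex1_fixed_point:
  assumes "orbitally_complete X d T"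
  shows "\<exists>!x. x \<in> X \<and> T x = x"
proof -
  obtain x where x: "x \<in> X"
    using carrier_nonempty by blast
  have "range (\<lambda>n. (T ^^ n) x) \<subseteq> fwd_orbit T x"
    by (simp add: fwd_orbit_def)
  then obtain u where "u \<in> X" "b_converges d (\<lambda>n. (T ^^ n) x) u"
    using assms x orbit_Cauchy[OF x] unfolding orbitally_complete_def by blast
  then show ?thesis
    using orbit_limit_fixed[OF x] fixed_point_unique by blast
qed

end

theorem corollary4p2:
  fixes X :: "'a set" and d :: "'a \<Rightarrow> 'a \<Rightarrow> real" and s k :: real and T :: "'a \<Rightarrow> 'a"
  assumes "b_metric_space X d s"
    and "b_complete X d"
    and "T \<in> X \<rightarrow> X"
    and "k \<in> {0..<1 / s}"
    and "\<And>x y. \<lbrakk>x \<in> X; y \<in> X\<rbrakk> \<Longrightarrow>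
           d (T x) (T y) \<le> k * Max {d x y, d x (T x), d y (T y), d x (T y), d y (T x)}"
    and "orbitally_complete X d T"
  shows "\<exists>!x. x \<in> X \<and> T x = x"
proof -
  interpret b_metric_space X d s
    by (rule assms(1))
  interpret b_metric_quasicontraction X d s T k
    using assms(3-5) coeff_ge_1 by unfold_locales (auto simp: field_simps)
  show ?thesis
    using assms(6) by (rule ex1_fixed_point)
qed

end
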